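(* Let $n\ge 2$, let $c_0,\dots,c_{n-1}$ be real numbers (not necessarily non-negative), and let $f(\lambda)=\sigma_n(\lambda)-\sum_{k=0}^{n-1}c_k\sigma_k(\lambda)$ for $\lambda=(\lambda_1,\dots,\lambda_n)\in\mathbb{R}^n$. Let $\Gamma_f^n$ be a connected component of $\{\lambda\in\mathbb{R}^n: f(\lambda)>0\}$. If $\Gamma_f^n$ is strictly $\Upsilon$-stable, then its boundary $\partial\Gamma_f^n$ is convex.
   Context: $\sigma_k(\lambda)$ denotes the $k$-th elementary symmetric polynomial of $\lambda_1,\dots,\lambda_n$, with $\sigma_0=1$. $\Gamma_n=\{\lambda\in\mathbb{R}^n:\lambda_i>0\text{ for all }i\}$ is the positive orthant. A connected component $\Gamma_f^n$ of $\{f>0\}$ is called $\Upsilon$-stable if $\Gamma_f^n\subseteq q+\Gamma_n$ for some $q\in\mathbb{R}^n$. Let $\Gamma_f^{n-1}\subseteq\mathbb{R}^{n-1}$ be the projection of $\Gamma_f^n$ obtained by dropping the last coordinate, and let $$\Upsilon_1=\{\mu\in\mathbb{R}^n:(\mu_{s(1)},\dots,\mu_{s(n-1)})\in\Gamma_f^{n-1}\ \text{ for all } s\in S_n\},$$ where $S_n$ is the symmetric group. $\Gamma_f^n$ is called strictly $\Upsilon$-stable if it is $\Upsilon$-stable and $\partial\Gamma_f^n\subseteq\Upsilon_1$. The hypersurface $\partial\Gamma_f^n$ being convex means that the closure $\overline{\Gamma_f^n}$ (the region it bounds) is a convex subset of $\mathbb{R}^n$. *)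

theory Defs
  imports "HOL-Analysis.Analysis"
begin

text \<open>
  Euclidean space of dimension n >= 2 is rendered as the type real ^ 'm option, with 'm an
  arbitrary finite type and n = CARD('m option) = CARD('m) + 1.  The index None is the last
  coordinate; the indices Some i are the first n - 1 coordinates, so that real ^ 'm is the
  space of dimension n - 1 onto which dropping the last coordinate projects.
\<close>

lemma two_le_card_option: "2 \<le> CARD('m::finite option)"
  by (simp add: Suc_le_eq)

definition elem_sym :: "nat \<Rightarrow> real ^ 'n \<Rightarrow> real" where
  "elem_sym k x = (\<Sum>S | S \<subseteq> (UNIV :: 'n set) \<and> card S = k. \<Prod>i\<in>S. x $ i)"

lemma elem_sym_0: "elem_sym 0 (x :: real ^ 'n) = 1"
proof -
  have "{S. S \<subseteq> (UNIV :: 'n set) \<and> card S = 0} = {{}}"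
    by auto
  then show ?thesis
    by (simp add: elem_sym_def)
qed

definition pos_orthant :: "(real ^ 'n) set" where
  "pos_orthant = {x. \<forall>i. 0 < x $ i}"

definition Upsilon_stable :: "(real ^ 'n) set \<Rightarrow> bool" where
  "Upsilon_stable G \<longleftrightarrow> (\<exists>q. G \<subseteq> (+) q ` pos_orthant)"

definition drop_last :: "real ^ 'm::finite option \<Rightarrow> real ^ 'm" where
  "drop_last x = (\<chi> i. x $ Some i)"

text \<open>
  The vector built from s below is (x at s(1), ..., x at s(n-1)), where s ranges over all
  permutations of the n indices, None included.
\<close>

definition Upsilon1 :: "(real ^ 'm::finite option) set \<Rightarrow> (real ^ 'm option) set" where
  "Upsilon1 G = {x. \<forall>s. s permutes (UNIV :: 'm option set) \<longrightarrow>
      (\<chi> i. x $ s (Some i)) \<in> drop_last ` G}"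

definition strictly_Upsilon_stable :: "(real ^ 'm::finite option) set \<Rightarrow> bool" where
  "strictly_Upsilon_stable G \<longleftrightarrow> Upsilon_stable G \<and> frontier G \<subseteq> Upsilon1 G"

text \<open>
  Convexity of the hypersurface frontier G means convexity of the closed region it bounds,
  not convexity of the point set frontier G.
\<close>

definition convex_boundary :: "(real ^ 'n) set \<Rightarrow> bool" where
  "convex_boundary G \<longleftrightarrow> convex (closure G)"

end

theory Submission
  imports Defs
begin

text \<open>
  The component \<open>G\<close> itself is convex, hence so is its closure.  The argument rests on
  three facts: \<open>f\<close> is affine in each variable, \<open>f\<close> is symmetric, and \<open>G\<close> is bounded below in every
  coordinate.

  The lower bound forces every partial derivative of \<open>f\<close> to be positive on \<open>G\<close> (\<open>slope_pos\<close>), so \<open>G\<close> is an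
  upper set.  The partial derivative in the variable \<open>k\<close> is a symmetric multi-affine function of the
  remaining variables, and the projection of \<open>G\<close> that drops \<open>k\<close> is for it what \<open>G\<close> is for \<open>f\<close>
  (\<open>stable_component_slope\<close>).  By induction on the number of variables these projections are convex.

  As a function of two variables \<open>p\<close>, \<open>q\<close> out of the \<open>n\<close>, with the others fixed,
  \<open>f = a + b (p + q) + c p q\<close> with \<open>c > 0\<close>.  Put \<open>\<beta> = b / c\<close>.  The set \<open>{f \<ge> e}\<close> within \<open>G\<close> is
  \<open>(p + \<beta>) (q + \<beta>) \<ge> (m + \<beta>)\<^sup>2\<close>, where \<open>m\<close> is the common value of \<open>p\<close> and \<open>q\<close> at the vertex of the hyperbola
  \<open>f = e\<close>.  Equivalently, the matrix with diagonal \<open>p\<close>, \<open>q\<close> and off-diagonal entry \<open>m\<close>, plus \<open>\<beta>\<close> times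
  the all-ones matrix, is positive semidefinite.  Convexity of the projections says that \<open>\<beta>\<close> is a
  concave function of the other variables.  Therefore, if the vertices of two hyperbolas can be
  joined inside the set, so can the points on them (\<open>averaging_reflects_interior\<close>): a failure of
  convexity does not get smaller when two coordinates of both end points are replaced by the
  coordinates of the vertices.  Such a replacement decreases the sum of the coordinates, and where no
  replacement changes anything both end points are the same point of the diagonal, where nothing
  fails.  A compactness argument turns this into a proof (\<open>convex_segment_on_slice\<close>).
\<close>

section \<open>Changing one coordinate\<close>

definition upd :: "real ^ 'n \<Rightarrow> 'n \<Rightarrow> real \<Rightarrow> real ^ 'n" where
  "upd x i t = (\<chi> j. if j = i then t else x $ j)"

lemma upd_nth [simp]: "upd x i t $ j = (if j = i then t else x $ j)"
  by (simp add: upd_def)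

lemma upd_upd [simp]: "upd (upd x i s) i t = upd x i t"
  by (simp add: vec_eq_iff)

lemma upd_self [simp]: "upd x i (x $ i) = x"
  by (simp add: vec_eq_iff)

lemma upd_commute: "i \<noteq> j \<Longrightarrow> upd (upd x i s) j t = upd (upd x j t) i s"
  by (simp add: vec_eq_iff)

lemma upd_eq_segment: "upd x i t = x + (t - x $ i) *\<^sub>R axis i 1"
  by (simp add: vec_eq_iff axis_def)

lemma continuous_on_upd: "continuous_on S (\<lambda>x. upd x i t)"
  unfolding upd_eq_segment by (intro continuous_intros)

text \<open>
  For a function that is affine in the coordinate \<open>i\<close>, this difference is its partial derivative
  in that coordinate, and it is again affine in every coordinate in which \<open>f\<close> is.
\<close>

definition slope :: "(real ^ 'n \<Rightarrow> real) \<Rightarrow> 'n \<Rightarrow> real ^ 'n \<Rightarrow> real" where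
  "slope f i x = f (upd x i 1) - f (upd x i 0)"

lemma slope_upd [simp]: "slope f i (upd x i t) = slope f i x"
  by (simp add: slope_def)

text \<open>
  The projection of \<open>C\<close> that forgets the coordinate \<open>k\<close>, kept in the same space as the cylinder over
  that projection.  The induction on the dimension can then stay inside one type: a function of fewer
  variables is a function that ignores some coordinates.
\<close>

definition cyl :: "'n \<Rightarrow> (real ^ 'n) set \<Rightarrow> (real ^ 'n) set" where
  "cyl k C = {x. \<exists>t. upd x k t \<in> C}"

lemma subset_cyl: "x \<in> C \<Longrightarrow> x \<in> cyl k C"
  unfolding cyl_def by (auto intro!: exI[of _ "x $ k"])

text \<open>
  If \<open>f = a + b (p + q) + c p q\<close> in the values \<open>p\<close>, \<open>q\<close> of the coordinates \<open>i\<close>, \<open>j\<close>, this is \<open>b / c\<close>.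
  Completing the product gives \<open>f = c (p + b/c) (q + b/c) + const\<close>, so the level sets of \<open>f\<close> in the
  plane of \<open>p\<close> and \<open>q\<close> are hyperbolas centred at \<open>(- b/c, - b/c)\<close>.
\<close>

definition shift :: "(real ^ 'n \<Rightarrow> real) \<Rightarrow> 'n \<Rightarrow> 'n \<Rightarrow> real ^ 'n \<Rightarrow> real" where
  "shift f i j w = slope f i (upd w j 0) / slope (slope f i) j w"

lemma cross_upd [simp]: "slope (slope f i) j (upd w i t) = slope (slope f i) j w"
  by (cases "i = j") (simp_all add: slope_def[of "slope f i"] upd_commute[of i j])

lemma shift_upd [simp]: "shift f i j (upd w j t) = shift f i j w"
    "shift f i j (upd w i t) = shift f i j w"
  by (cases "i = j"; simp add: shift_def upd_commute[of i j])+

text \<open>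
  A symmetric 2 by 2 matrix with diagonal \<open>X\<close>, \<open>Y\<close> and off-diagonal entry \<open>Z\<close> is positive semidefinite
  exactly if \<open>X\<close>, \<open>Y\<close> are nonnegative and \<open>Z\<^sup>2 \<le> X Y\<close>; such matrices form a convex cone.
\<close>

lemma convex_combination_geometric_mean:
  fixes X1 Y1 Z1 X2 Y2 Z2 u v :: real
  assumes 1: "0 < X1" "0 < Y1" "0 < Z1" "Z1\<^sup>2 \<le> X1 * Y1"
    and 2: "0 < X2" "0 < Y2" "0 < Z2" "Z2\<^sup>2 \<le> X2 * Y2"
    and uv: "0 \<le> u" "0 \<le> v" "u + v = 1"
  shows "0 < u * X1 + v * X2" "0 < u * Y1 + v * Y2" "0 < u * Z1 + v * Z2"
    "(u * Z1 + v * Z2)\<^sup>2 \<le> (u * X1 + v * X2) * (u * Y1 + v * Y2)"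
proof -
  have pos: "0 < u * a + v * b" if "0 < a" "0 < b" for a b :: real
    using that uv by (cases "u = 0") (auto intro!: add_pos_nonneg)
  show "0 < u * X1 + v * X2" "0 < u * Y1 + v * Y2" "0 < u * Z1 + v * Z2"
    using 1 2 pos by auto
  have "(2 * (Z1 * Z2))\<^sup>2 \<le> (X1 * Y2 + X2 * Y1)\<^sup>2"
  proof -
    have "(2 * (Z1 * Z2))\<^sup>2 = 4 * (Z1\<^sup>2 * Z2\<^sup>2)" by (simp add: power2_eq_square)
    also have "\<dots> \<le> 4 * ((X1 * Y1) * (X2 * Y2))"
      using 1 2 by (intro mult_left_mono mult_mono) auto
    also have "\<dots> = (X1 * Y2 + X2 * Y1)\<^sup>2 - (X1 * Y2 - X2 * Y1)\<^sup>2"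
      by (simp add: power2_eq_square algebra_simps)
    also have "\<dots> \<le> (X1 * Y2 + X2 * Y1)\<^sup>2" by simp
    finally show ?thesis .
  qed
  then have "2 * (Z1 * Z2) \<le> X1 * Y2 + X2 * Y1"
    by (rule power2_le_imp_le) (use 1 2 in \<open>auto intro!: add_nonneg_nonneg\<close>)
  then have "u * v * (2 * (Z1 * Z2)) \<le> u * v * (X1 * Y2 + X2 * Y1)"
    using uv by (intro mult_left_mono) auto
  moreover have "u * u * Z1\<^sup>2 \<le> u * u * (X1 * Y1)" "v * v * Z2\<^sup>2 \<le> v * v * (X2 * Y2)"
    using 1 2 by (auto intro!: mult_left_mono)
  ultimately show "(u * Z1 + v * Z2)\<^sup>2 \<le> (u * X1 + v * X2) * (u * Y1 + v * Y2)"
    by (simp add: power2_eq_square algebra_simps)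
qed

section \<open>Stable components of symmetric multi-affine functions\<close>

text \<open>
  The hypotheses on a component that survive differentiation in one variable.  Here \<open>A\<close> is the set of
  the variables of \<open>f\<close>.  Connectedness enters only as \<open>reach\<close>: since \<open>f\<close> is affine along coordinate
  lines, it is positive on a whole axis-parallel segment once it is positive at both ends, so a
  component of \<open>{f > 0}\<close> contains both ends of such a segment or neither.  Unlike connectedness, this
  condition is easy to pass on to the projection of \<open>C\<close>.
\<close>

locale stable_component =
  fixes A :: "'n::finite set" and f :: "real ^ 'n \<Rightarrow> real" and C :: "(real ^ 'n) set" and L :: real
  assumes affine: "f (upd x i t) = f (upd x i 0) + t * slope f i x"
    and symm: "i \<in> A \<Longrightarrow> j \<in> A \<Longrightarrow> i \<noteq> j \<Longrightarrow> f (upd (upd x i s) j t) = f (upd (upd x i t) j s)"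
    and indep: "i \<notin> A \<Longrightarrow> f (upd x i t) = f x"
    and cont: "continuous_on UNIV f"
    and pos: "x \<in> C \<Longrightarrow> 0 < f x"
    and reach: "x \<in> C \<Longrightarrow> 0 < f (upd x i t) \<Longrightarrow> upd x i t \<in> C"
    and lower: "x \<in> C \<Longrightarrow> i \<in> A \<Longrightarrow> L \<le> x $ i"
begin

lemma affine_at: "f (upd x i t) = f x + (t - x $ i) * slope f i x"
  using affine[of x i t] affine[of x i "x $ i"] by (simp add: algebra_simps)

lemma mem_if_cyl_pos:
  assumes "x \<in> cyl k C" "0 < f x"
  shows "x \<in> C"
proof -
  obtain t where "upd x k t \<in> C" using assms(1) by (auto simp: cyl_def)
  from reach[OF this, of k "x $ k"] show ?thesis using assms(2) by simp
qed

text \<open>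
  If \<open>f\<close> did not increase with the coordinate \<open>k\<close>, then lowering \<open>k\<close> would keep \<open>f\<close> positive, and one
  could leave the half-space \<open>x $ k \<ge> L\<close> without leaving \<open>C\<close>.
\<close>

lemma slope_pos:
  assumes "k \<in> A" "x \<in> cyl k C"
  shows "0 < slope f k x"
proof (rule ccontr)
  assume neg: "\<not> 0 < slope f k x"
  obtain t where t: "upd x k t \<in> C"
    using assms(2) by (auto simp: cyl_def)
  define s where "s = min t L - 1"
  have "(s - t) * slope f k x \<ge> 0"
    using neg by (simp add: s_def mult_nonpos_nonpos)
  then have "0 < f (upd x k s)"
    using affine_at[of "upd x k t" k s] pos[OF t] by simp
  then have "upd x k s \<in> C"
    using reach[OF t, of k s] by simp
  then show False
    using lower[of "upd x k s" k] assms(1) by (simp add: s_def)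
qed

lemma slope_affine: "slope f k (upd x i t) = slope f k (upd x i 0) + t * slope (slope f k) i x"
proof (cases "i = k")
  case True
  then show ?thesis by (simp add: slope_def)
next
  case False
  have "f (upd (upd x i t) k r) = f (upd (upd x i 0) k r) + t * slope f i (upd x k r)" for r
    using affine[of "upd x k r" i t] False by (simp add: upd_commute)
  then show ?thesis
    using False by (simp add: slope_def upd_commute algebra_simps)
qed

text \<open>
  This is what makes induction on the number of variables possible.  The only condition that needs
  an idea is \<open>reach\<close>: for large \<open>x $ k\<close> the sign of \<open>f\<close> is the sign of its partial derivative, so a
  move in the projection lifts to a move in \<open>C\<close> far out in the direction \<open>k\<close>.
\<close>

lemma stable_component_slope:
  assumes k: "k \<in> A"
  shows "stable_component (A - {k}) (slope f k) (cyl k C) L"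
proof
  fix x :: "real ^ 'n" and i t
  show "slope f k (upd x i t) = slope f k (upd x i 0) + t * slope (slope f k) i x"
    by (rule slope_affine)
next
  fix x :: "real ^ 'n" and i j s t
  assume "i \<in> A - {k}" "j \<in> A - {k}" "i \<noteq> j"
  then have "f (upd (upd (upd x i s) j t) k r) = f (upd (upd (upd x i t) j s) k r)" for r
    using symm[of i j "upd x k r" s t] by (auto simp: upd_commute[of _ k])
  then show "slope f k (upd (upd x i s) j t) = slope f k (upd (upd x i t) j s)"
    by (simp add: slope_def)
next
  fix x :: "real ^ 'n" and i t
  assume "i \<notin> A - {k}"
  then show "slope f k (upd x i t) = slope f k x"
    using indep by (cases "i = k") (auto simp: slope_def upd_commute[of i k])
next
  have "continuous_on UNIV (\<lambda>x. f (upd x k r))" for r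
    by (rule continuous_on_compose2[OF cont continuous_on_upd]) auto
  then show "continuous_on UNIV (slope f k)"
    unfolding slope_def by (intro continuous_intros)
next
  fix x assume "x \<in> cyl k C"
  then show "0 < slope f k x" by (rule slope_pos[OF k])
next
  fix x i t
  assume x: "x \<in> cyl k C" and p: "0 < slope f k (upd x i t)"
  show "upd x i t \<in> cyl k C"
  proof (cases "i = k")
    case True
    with x show ?thesis by (simp add: cyl_def)
  next
    case False
    obtain s where s: "upd x k s \<in> C" using x by (auto simp: cyl_def)
    (* At this height both ends of the move in direction i satisfy f > 0. *)
    define R where "R = max s ((1 - f (upd (upd x i t) k 0)) / slope f k (upd x i t))"
    have "(R - s) * slope f k x \<ge> 0"
      using slope_pos[OF k x] by (simp add: R_def)
    then have "0 < f (upd x k R)"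
      using affine_at[of "upd x k s" k R] pos[OF s] by simp
    then have 1: "upd x k R \<in> C"
      using reach[OF s, of k R] by simp
    have "(1 - f (upd (upd x i t) k 0)) / slope f k (upd x i t) \<le> R"
      by (simp add: R_def)
    then have "1 - f (upd (upd x i t) k 0) \<le> R * slope f k (upd x i t)"
      using p by (simp add: pos_divide_le_eq)
    then have "0 < f (upd (upd x i t) k R)"
      using affine[of "upd x i t" k R] by simp
    then have "upd (upd x i t) k R \<in> C"
      using reach[OF 1, of i t] False by (simp add: upd_commute)
    then show ?thesis by (auto simp: cyl_def)
  qed
next
  fix x i
  assume "x \<in> cyl k C" "i \<in> A - {k}"
  then show "L \<le> x $ i"
    using lower[of "upd x k t" i for t] by (auto simp: cyl_def)
qed

lemma raise_coordinate:
  assumes "x \<in> C" "x $ i \<le> t \<or> i \<notin> A"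
  shows "upd x i t \<in> C" "f x \<le> f (upd x i t)"
proof -
  show le: "f x \<le> f (upd x i t)"
  proof (cases "i \<in> A")
    case True
    then have "0 \<le> (t - x $ i) * slope f i x"
      using assms slope_pos[OF True subset_cyl[OF assms(1)]] by simp
    then show ?thesis using affine_at[of x i t] by simp
  qed (simp add: indep)
  show "upd x i t \<in> C"
    using reach[OF assms(1), of i t] pos[OF assms(1)] le by simp
qed

text \<open>
  Only coordinates in \<open>A\<close> are compared, so the lemma also says that membership in \<open>C\<close> and the value of
  \<open>f\<close> do not depend on the other coordinates.
\<close>

lemma monotone_on_component:
  assumes x: "x \<in> C" and le: "\<And>i. i \<in> A \<Longrightarrow> x $ i \<le> y $ i"
  shows "y \<in> C" "f x \<le> f y"
proof -
  define h where "h S = (\<chi> i. if i \<in> S then y $ i else x $ i)" for S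
  have "h S \<in> C \<and> f x \<le> f (h S)" if "finite S" for S :: "'n set"
    using that
  proof induction
    case empty
    show ?case using x by (simp add: h_def vec_lambda_eta)
  next
    case (insert i S)
    have e: "h (insert i S) = upd (h S) i (y $ i)"
      by (auto simp: h_def vec_eq_iff)
    have "h S $ i \<le> y $ i \<or> i \<notin> A"
      using insert le by (auto simp: h_def)
    then show ?case
      unfolding e using raise_coordinate[of "h S" i "y $ i"] insert.IH by auto
  qed
  from this[of UNIV] show "y \<in> C" "f x \<le> f y"
    by (simp_all add: h_def vec_lambda_eta)
qed

lemma strict_monotone_on_component:
  assumes x: "x \<in> C" and le: "\<And>i. i \<in> A \<Longrightarrow> x $ i \<le> y $ i"
    and k: "k \<in> A" "x $ k < y $ k"
  shows "f x < f y"
proof -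
  have "0 < (y $ k - x $ k) * slope f k x"
    using k slope_pos[OF k(1) subset_cyl[OF x]] by simp
  then have "f x < f (upd x k (y $ k))"
    using affine_at[of x k "y $ k"] by simp
  also have "\<dots> \<le> f y"
    using raise_coordinate[OF x, of k "y $ k"] k le
    by (intro monotone_on_component(2)) auto
  finally show ?thesis .
qed

section \<open>Topology of a stable component\<close>

text \<open>
  The points \<open>w\<close> are the corners of the box spanned by \<open>x\<close> and \<open>y\<close>; changing the coordinates one at a
  time leads from \<open>x\<close> to \<open>y\<close> through some of them.  When \<open>x\<close> or \<open>y\<close> is the centre of a ball that
  contains the other, all corners lie in this ball, and this is how openness and relative closedness
  of \<open>C\<close> in \<open>{f > 0}\<close> follow.
\<close>

lemma reach_by_coordinates:
  assumes "x \<in> C" and "\<And>w. (\<And>i. w $ i = x $ i \<or> w $ i = y $ i) \<Longrightarrow> 0 < f w"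
  shows "y \<in> C"
proof -
  define h where "h S = (\<chi> i. if i \<in> S then y $ i else x $ i)" for S
  have "h S \<in> C" if "finite S" for S :: "'n set"
    using that
  proof induction
    case empty
    show ?case using assms(1) by (simp add: h_def vec_lambda_eta)
  next
    case (insert i S)
    have e: "h (insert i S) = upd (h S) i (y $ i)"
      by (auto simp: h_def vec_eq_iff)
    have "0 < f (h (insert i S))"
      by (rule assms(2)) (simp add: h_def)
    then show ?case
      using reach[OF insert.IH, of i "y $ i"] by (simp add: e)
  qed
  from this[of UNIV] show ?thesis
    by (simp add: h_def vec_lambda_eta)
qed

lemma positive_ball:
  assumes "0 < f c"
  obtains d where "0 < d" "\<And>w. dist w c < d \<Longrightarrow> 0 < f w"
proof -
  have "open {w. 0 < f w}"
    using cont by (simp add: open_Collect_less)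
  then show ?thesis
    using that assms by (auto simp: open_dist)
qed

lemma dist_le_of_components:
  fixes w x c :: "real ^ 'n"
  assumes "\<And>i. w $ i = x $ i \<or> w $ i = c $ i"
  shows "dist w c \<le> dist x c"
  unfolding dist_norm
proof (rule norm_le_componentwise_cart)
  fix i show "norm ((w - c) $ i) \<le> norm ((x - c) $ i)"
    using assms[of i] by auto
qed

lemma open_component: "open C"
  unfolding open_dist
proof
  fix x assume x: "x \<in> C"
  obtain d where d: "0 < d" "\<And>w. dist w x < d \<Longrightarrow> 0 < f w"
    using positive_ball[OF pos[OF x]] by blast
  have "y \<in> C" if "dist y x < d" for y
  proof (rule reach_by_coordinates[OF x])
    fix w assume "\<And>i. w $ i = x $ i \<or> w $ i = y $ i"
    then have "dist w x \<le> dist y x"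
      by (intro dist_le_of_components) auto
    then show "0 < f w" using d(2) that by simp
  qed
  then show "\<exists>e>0. \<forall>y. dist y x < e \<longrightarrow> y \<in> C"
    using d(1) by blast
qed

lemma closed_superlevel:
  assumes "0 < e"
  shows "closed {x \<in> C. e \<le> f x}"
  unfolding closed_limpt
proof (intro allI impI)
  fix x assume lim: "x islimpt {x \<in> C. e \<le> f x}"
  have "closed {x. e \<le> f x}"
    using cont by (simp add: closed_Collect_le)
  then have ge: "e \<le> f x"
    using islimpt_subset[OF lim, of "{x. e \<le> f x}"] by (auto simp: closed_limpt)
  obtain d where d: "0 < d" "\<And>w. dist w x < d \<Longrightarrow> 0 < f w"
    using positive_ball[of x] ge assms by auto
  obtain y where y: "y \<in> C" "dist y x < d"
    using lim d(1) unfolding islimpt_approachable by blast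
  have "x \<in> C"
  proof (rule reach_by_coordinates[OF y(1)])
    fix w assume "\<And>i. w $ i = y $ i \<or> w $ i = x $ i"
    then have "dist w x \<le> dist y x"
      by (rule dist_le_of_components)
    then show "0 < f w" using d(2) y(2) by simp
  qed
  with ge show "x \<in> {x \<in> C. e \<le> f x}" by simp
qed


section \<open>Two coordinates: hyperbolas and averaging\<close>

text \<open>
  Apply \<open>slope_pos\<close> to the projection: it is itself a stable component of the partial derivative.
\<close>

lemma cross_pos:
  assumes "i \<in> A" "j \<in> A" "i \<noteq> j" "w \<in> cyl i C"
  shows "0 < slope (slope f i) j w"
proof -
  interpret D: stable_component "A - {i}" "slope f i" "cyl i C" L
    by (rule stable_component_slope[OF assms(1)])
  show ?thesis
    using D.slope_pos[of j w] subset_cyl[OF assms(4)] assms(1-3) by simp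
qed

lemma slope_product:
  assumes "slope (slope f i) j w \<noteq> 0"
  shows "slope f i w = slope (slope f i) j w * (w $ j + shift f i j w)"
  using slope_affine[of i w j "w $ j"] assms
  by (simp add: shift_def field_simps)

lemma level_product:
  assumes ij: "i \<in> A" "j \<in> A" "i \<noteq> j" and c: "slope (slope f i) j w \<noteq> 0"
  shows "f (upd (upd w i p) j q) = f w + slope (slope f i) j w *
    ((p + shift f i j w) * (q + shift f i j w) - (w $ i + shift f i j w) * (w $ j + shift f i j w))"
proof -
  let ?c = "slope (slope f i) j w" and ?b = "slope f i (upd w j 0)"
  have F: "f (upd (upd w i p) j q) = f (upd (upd w i 0) j 0) + ?b * (p + q) + ?c * p * q" for p q
  proof -
    have 1: "f (upd (upd w i p) j q) = f (upd (upd w i 0) j q) + p * (?b + q * ?c)" for p q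
      using affine[of "upd w j q" i p] slope_affine[of i w j q] ij(3)
      by (simp add: upd_commute[of i j])
    show ?thesis
      using 1[of p q] 1[of q 0] symm[OF ij, of w 0 q] by (simp add: algebra_simps)
  qed
  have b: "?b = ?c * shift f i j w"
    using c by (simp add: shift_def)
  show ?thesis
    using F[of p q] F[of "w $ i" "w $ j"] unfolding b by (simp add: algebra_simps)
qed

text \<open>
  Up to the positive factor \<open>c\<close>, the two factors are the partial derivatives of \<open>f\<close> in \<open>j\<close> and \<open>i\<close>:
  the points of \<open>C\<close> lie above and to the right of the centre of their hyperbola.
\<close>

lemma factors_pos:
  assumes ij: "i \<in> A" "j \<in> A" "i \<noteq> j" and w: "w \<in> C"
  shows "0 < w $ i + shift f i j w" "0 < w $ j + shift f i j w"
proof -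
  have c: "0 < slope (slope f i) j w"
    by (rule cross_pos[OF ij subset_cyl[OF w]])
  have "slope f j w = slope (slope f i) j w * (w $ i + shift f i j w)"
    using level_product[OF ij, of w "w $ i" 1] level_product[OF ij, of w "w $ i" 0] c
    by (simp add: slope_def[of f j] algebra_simps)
  then show "0 < w $ i + shift f i j w"
    using slope_pos[OF ij(2) subset_cyl[OF w]] c by (simp add: zero_less_mult_iff)
  show "0 < w $ j + shift f i j w"
    using slope_product[of i j w] slope_pos[OF ij(1) subset_cyl[OF w]] c
    by (simp add: zero_less_mult_iff)
qed

text \<open>
  Changing \<open>i\<close> is harmless in the projection that forgets \<open>i\<close>, and there the change of \<open>j\<close> is allowed
  because the partial derivative in \<open>i\<close> stays positive.  A point over the projection belongs to \<open>C\<close> as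
  soon as \<open>f\<close> is positive at it.
\<close>

lemma reenter:
  assumes ij: "i \<in> A" "j \<in> A" "i \<noteq> j" and w: "w \<in> C"
    and q: "0 < q + shift f i j w" and fpos: "0 < f (upd (upd w i p) j q)"
  shows "upd (upd w i p) j q \<in> C"
proof -
  interpret D: stable_component "A - {i}" "slope f i" "cyl i C" L
    by (rule stable_component_slope[OF ij(1)])
  have c: "0 < slope (slope f i) j w"
    by (rule cross_pos[OF ij subset_cyl[OF w]])
  have 1: "upd w i p \<in> cyl i C"
    using subset_cyl[OF w] by (simp add: cyl_def)
  have "slope f i (upd (upd w i p) j q) = slope (slope f i) j w * (q + shift f i j w)"
    using slope_product[of i j "upd (upd w i p) j q"] c ij(3) by simp
  then have "upd (upd w i p) j q \<in> cyl i C"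
    using D.reach[OF 1, of j q] c q by simp
  then show ?thesis
    using fpos by (rule mem_if_cyl_pos)
qed

text \<open>
  The vertex of the hyperbola \<open>f = e\<close> in the plane of the coordinates \<open>i\<close>, \<open>j\<close>.  By the inequality of
  arithmetic and geometric means, among the points of the region \<open>f \<ge> e\<close> on the upper branch it is the
  only one with the smallest coordinate sum.
\<close>

lemma average_coordinates:
  assumes ij: "i \<in> A" "j \<in> A" "i \<noteq> j" and x: "x \<in> C" and e: "0 < e" "e \<le> f x"
  obtains m where "upd (upd x i m) j m \<in> C" "f (upd (upd x i m) j m) = e"
    "2 * m \<le> x $ i + x $ j" "2 * m = x $ i + x $ j \<Longrightarrow> x $ i = m \<and> x $ j = m"
proof -
  define b c X Y where "b = shift f i j x" and "c = slope (slope f i) j x"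
    and "X = x $ i + b" and "Y = x $ j + b"
  have c: "0 < c"
    unfolding c_def by (rule cross_pos[OF ij subset_cyl[OF x]])
  have XY: "0 < X" "0 < Y"
    using factors_pos[OF ij x] by (simp_all add: X_def Y_def b_def)
  have F: "f (upd (upd x i p) j q) = f x + c * ((p + b) * (q + b) - X * Y)" for p q
    using level_product[OF ij, of x p q] c by (simp add: c_def b_def X_def Y_def)
  (* In the shifted coordinates the level e is the hyperbola where the product equals d. *)
  define d where "d = X * Y - (f x - e) / c"
  have Fd: "f (upd (upd x i p) j q) = e + c * ((p + b) * (q + b) - d)" for p q
  proof -
    have "c * d = c * (X * Y) - c * ((f x - e) / c)"
      by (simp only: d_def right_diff_distrib)
    then have "c * d = c * (X * Y) - (f x - e)"
      using c by simp
    then show ?thesis using F[of p q] by (simp add: algebra_simps)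
  qed
  have d: "0 < d"
  proof (rule ccontr)
    assume "\<not> 0 < d"
    (* The hyperbola does not separate x from the asymptote: C would contain a point with a
       vanishing second factor. *)
    then have "c * d \<le> 0"
      using c by (simp add: mult_le_0_iff)
    then have "0 < f (upd x j (- b))"
      using Fd[of "x $ i" "- b"] e by simp
    then have "upd x j (- b) \<in> C"
      by (rule reach[OF x])
    then show False
      using factors_pos(2)[OF ij, of "upd x j (- b)"] by (simp add: b_def)
  qed
  define z where "z = sqrt d"
  have z: "0 < z" "z * z = d"
    using d by (simp_all add: z_def)
  have fm: "f (upd (upd x i (z - b)) j (z - b)) = e"
    using Fd[of "z - b" "z - b"] z by simp
  have "d \<le> X * Y"
    using c e by (simp add: d_def)
  have sq: "(X + Y)\<^sup>2 = (X - Y)\<^sup>2 + 4 * (X * Y - z * z) + (2 * z)\<^sup>2"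
    by (simp add: power2_eq_square algebra_simps)
  have gap: "0 \<le> X * Y - z * z"
    using \<open>d \<le> X * Y\<close> z(2) by linarith
  have "(2 * z)\<^sup>2 \<le> (X + Y)\<^sup>2"
    unfolding sq using gap by simp
  then have le: "2 * z \<le> X + Y"
    by (rule power2_le_imp_le) (use XY in simp)
  have eq: "X = z \<and> Y = z" if "2 * z = X + Y"
  proof -
    have "(X - Y)\<^sup>2 + 4 * (X * Y - z * z) = 0"
      using sq unfolding that by simp
    then have "X = Y"
      using gap by (subst (asm) add_nonneg_eq_0_iff) auto
    with that show ?thesis by simp
  qed
  show ?thesis
  proof (rule that)
    show "upd (upd x i (z - b)) j (z - b) \<in> C"
      by (rule reenter[OF ij x]) (use fm z e in \<open>simp_all add: b_def\<close>)
    show "f (upd (upd x i (z - b)) j (z - b)) = e"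
      by (rule fm)
    show "2 * (z - b) \<le> x $ i + x $ j"
      using le by (simp add: X_def Y_def)
    show "x $ i = z - b \<and> x $ j = z - b" if "2 * (z - b) = x $ i + x $ j"
      using eq that by (simp add: X_def Y_def algebra_simps)
  qed
qed

text \<open>
  The region \<open>cyl i C\<close> of the partial derivative in \<open>i\<close> is \<open>x $ j > - shift f i j x\<close>, the strict epigraph
  of \<open>- shift\<close>.  Its convexity makes \<open>shift\<close> concave, and since it is an upper set, moving up by \<open>t\<close>
  along the diagonal lowers \<open>shift\<close> by at most \<open>t\<close>.  The inequality combines both facts.
\<close>

lemma shift_concave:
  assumes ij: "i \<in> A" "j \<in> A" "i \<noteq> j" and cv: "convex (cyl i C)"
    and xy: "x \<in> C" "y \<in> C" and uv: "0 \<le> u" "0 \<le> v" "u + v = 1" and t: "0 \<le> t"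
    and p: "p = u *\<^sub>R x + v *\<^sub>R y + t *\<^sub>R 1"
  shows "u * shift f i j x + v * shift f i j y \<le> t + shift f i j p"
proof (rule field_le_epsilon)
  fix s :: real assume s: "0 < s"
  interpret D: stable_component "A - {i}" "slope f i" "cyl i C" L
    by (rule stable_component_slope[OF ij(1)])
  (* The point at height s above the boundary of the epigraph, over the given point. *)
  define lift where "lift w = upd w j (s - shift f i j w)" for w
  have lift: "lift w \<in> cyl i C" if w: "w \<in> C" for w
  proof -
    have c: "0 < slope (slope f i) j w"
      by (rule cross_pos[OF ij subset_cyl[OF w]])
    then have "0 < slope f i (lift w)"
      using slope_product[of i j "lift w"] s by (simp add: lift_def)
    then show ?thesis
      using D.reach[OF subset_cyl[OF w]] by (simp add: lift_def)
  qed
  have up: "w + t *\<^sub>R 1 \<in> cyl i C" if "w \<in> cyl i C" for w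
    by (rule D.monotone_on_component(1)[OF that]) (use t in simp)
  have "u *\<^sub>R x + v *\<^sub>R y \<in> cyl i C"
    using cv xy uv subset_cyl by (intro convexD) auto
  then have c: "0 < slope (slope f i) j p"
    unfolding p by (intro cross_pos[OF ij] up)
  have "u *\<^sub>R lift x + v *\<^sub>R lift y \<in> cyl i C"
    using cv lift xy uv by (intro convexD) auto
  then have m: "u *\<^sub>R lift x + v *\<^sub>R lift y + t *\<^sub>R 1 \<in> cyl i C"
    by (rule up)
  have "s = u * s + v * s"
    using uv(3) by (simp flip: distrib_right)
  then have "u *\<^sub>R lift x + v *\<^sub>R lift y + t *\<^sub>R 1 =
      upd p j (s - (u * shift f i j x + v * shift f i j y) + t)"
    by (simp add: vec_eq_iff lift_def p algebra_simps)
  with m have "0 < slope f i (upd p j (s - (u * shift f i j x + v * shift f i j y) + t))"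
    using slope_pos[OF ij(1)] by simp
  then have "0 < s - (u * shift f i j x + v * shift f i j y) + t + shift f i j p"
    using slope_product[of i j "upd p j (s - (u * shift f i j x + v * shift f i j y) + t)"] c
    by (simp add: zero_less_mult_iff)
  then show "u * shift f i j x + v * shift f i j y \<le> t + shift f i j p + s"
    by simp
qed

text \<open>
  The heart of the proof.  Write \<open>\<beta>\<close> for \<open>shift\<close>.  For \<open>x\<close> the matrix with diagonal \<open>x $ i + \<beta> x\<close>,
  \<open>x $ j + \<beta> x\<close> and off-diagonal entry \<open>m + \<beta> x\<close> is positive semidefinite, because \<open>f x\<close> is at least
  the level of the vertex \<open>x'\<close>; likewise for \<open>y\<close>.  So is the convex combination of the two
  matrices, and it remains so when a nonnegative multiple \<open>s\<close> of the all-ones matrix is added.  By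
  \<open>shift_concave\<close> a suitable \<open>s\<close> turns the result into the matrix with diagonal \<open>p $ i + \<beta> p\<close>,
  \<open>p $ j + \<beta> p\<close> whose off-diagonal entry is the common value of \<open>p' $ i + \<beta> p\<close> and \<open>p' $ j + \<beta> p\<close>,
  where \<open>p\<close> and \<open>p'\<close> are the two combinations, shifted by \<open>t\<close>.  Semidefiniteness then reads
  \<open>f p' \<le> f p\<close>.
\<close>

lemma averaging_reflects_interior:
  assumes ij: "i \<in> A" "j \<in> A" "i \<noteq> j" and cv: "convex (cyl i C)"
    and x: "x \<in> C" "e \<le> f x" and y: "y \<in> C" "e \<le> f y" and e: "0 < e"
    and x': "x' = upd (upd x i m) j m" "x' \<in> C" "f x' = e"
    and y': "y' = upd (upd y i n) j n" "y' \<in> C" "f y' = e"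
    and uv: "0 \<le> u" "0 \<le> v" "u + v = 1" and t: "0 \<le> t"
    and p': "u *\<^sub>R x' + v *\<^sub>R y' + t *\<^sub>R 1 \<in> C" "e < f (u *\<^sub>R x' + v *\<^sub>R y' + t *\<^sub>R 1)"
  shows "u *\<^sub>R x + v *\<^sub>R y + t *\<^sub>R 1 \<in> C" "e < f (u *\<^sub>R x + v *\<^sub>R y + t *\<^sub>R 1)"
proof -
  define p p' where "p = u *\<^sub>R x + v *\<^sub>R y + t *\<^sub>R 1"
    and "p' = u *\<^sub>R x' + v *\<^sub>R y' + t *\<^sub>R 1"
  define b where "b = shift f i j"
  have pp': "p = upd (upd p' i (p $ i)) j (p $ j)"
    by (simp add: vec_eq_iff p_def p'_def x'(1) y'(1))
  have "b p' = b (upd (upd p' i (p $ i)) j (p $ j))"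
    by (simp add: b_def)
  then have b: "b p' = b p"
    by (simp only: pp'[symmetric])
  have slice: "0 < w $ i + b w \<and> 0 < w $ j + b w \<and> 0 < k + b w \<and>
      (k + b w)\<^sup>2 \<le> (w $ i + b w) * (w $ j + b w)"
    if w: "w \<in> C" "e \<le> f w" "upd (upd w i k) j k \<in> C" "f (upd (upd w i k) j k) = e" for w k
  proof -
    have c: "0 < slope (slope f i) j w"
      by (rule cross_pos[OF ij subset_cyl[OF w(1)]])
    then have "slope (slope f i) j w * ((k + b w)\<^sup>2 - (w $ i + b w) * (w $ j + b w)) \<le> 0"
      using level_product[OF ij, of w k k] w(2,4) by (simp add: b_def power2_eq_square)
    then have "(k + b w)\<^sup>2 \<le> (w $ i + b w) * (w $ j + b w)"
      using c by (simp add: mult_le_0_iff)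
    then show ?thesis
      using factors_pos[OF ij w(1)] factors_pos[OF ij w(3)] ij(3) by (simp add: b_def)
  qed
  note sx = slice[OF x, of m] and sy = slice[OF y, of n]
  (* The multiple of the all-ones matrix. *)
  define s where "s = t + b p - (u * b x + v * b y)"
  have s: "0 \<le> s"
    using shift_concave[OF ij cv x(1) y(1) uv t p_def] by (simp add: s_def b_def)
  define P Q Z where "P = u * (x $ i + b x) + v * (y $ i + b y)"
    and "Q = u * (x $ j + b x) + v * (y $ j + b y)"
    and "Z = u * (m + b x) + v * (n + b y)"
  have coords: "p $ i + b p = P + s" "p $ j + b p = Q + s"
     "p' $ i + b p = Z + s" "p' $ j + b p = Z + s"
    using ij(3) by (simp_all add: p_def p'_def x'(1) y'(1) P_def Q_def Z_def s_def algebra_simps)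
  have PQZ: "0 < P" "0 < Q" "0 < Z" "Z\<^sup>2 \<le> P * Q"
    unfolding P_def Q_def Z_def
    using convex_combination_geometric_mean[of "x $ i + b x" "x $ j + b x" "m + b x"
       "y $ i + b y" "y $ j + b y" "n + b y" u v] sx sy x' y' x y uv by simp_all
  have "Z \<le> (P + Q) / 2"
  proof (rule power2_le_imp_le)
    have "4 * (P * Q) = (P + Q)\<^sup>2 - (P - Q)\<^sup>2" by (simp add: power2_eq_square algebra_simps)
    then have "4 * (P * Q) \<le> (P + Q)\<^sup>2" by simp
    then show "Z\<^sup>2 \<le> ((P + Q) / 2)\<^sup>2"
      using PQZ by (simp add: power_divide)
  qed (use PQZ in simp)
  then have "s * (2 * Z) \<le> s * (P + Q)"
    using s by (intro mult_left_mono) auto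
  then have grow: "(Z + s) * (Z + s) \<le> (P + s) * (Q + s)"
    using PQZ(4) by (simp add: power2_eq_square algebra_simps)
  have c: "0 < slope (slope f i) j p'"
    using p'(1) unfolding p'_def[symmetric] by (intro cross_pos[OF ij] subset_cyl)
  have "f p = f p' + slope (slope f i) j p' * ((P + s) * (Q + s) - (Z + s) * (Z + s))"
    using level_product[OF ij, of p' "p $ i" "p $ j"] c
    unfolding pp'[symmetric] b_def[symmetric] b coords by simp
  then have "f p' \<le> f p"
    using grow c by simp
  then show fp: "e < f (u *\<^sub>R x + v *\<^sub>R y + t *\<^sub>R 1)"
    using p'(2) by (simp add: p_def p'_def)
  have "upd (upd p' i (p $ i)) j (p $ j) \<in> C"
  proof (rule reenter[OF ij])
    show "p' \<in> C" using p'(1) by (simp add: p'_def)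
    show "0 < p $ j + shift f i j p'"
      using coords PQZ s b by (simp add: b_def)
    show "0 < f (upd (upd p' i (p $ i)) j (p $ j))"
      unfolding pp'[symmetric] using fp e by (simp add: p_def)
  qed
  then show "u *\<^sub>R x + v *\<^sub>R y + t *\<^sub>R 1 \<in> C"
    unfolding pp'[symmetric] by (simp add: p_def)
qed


section \<open>The extremal argument\<close>

lemma boundary_above:
  assumes e: "0 < e" and hi: "z + T *\<^sub>R 1 \<in> C" "e < f (z + T *\<^sub>R 1)"
    and lo: "\<not> (z + t *\<^sub>R 1 \<in> C \<and> e < f (z + t *\<^sub>R 1))"
  obtains s where "t \<le> s" "z + s *\<^sub>R 1 \<in> C" "f (z + s *\<^sub>R 1) = e"
proof -
  let ?r = "\<lambda>s. z + s *\<^sub>R 1"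
  have r: "continuous_on UNIV ?r" by (intro continuous_intros)
  have tT: "t \<le> T"
  proof (rule ccontr)
    assume "\<not> t \<le> T"
    then show False
      using monotone_on_component[OF hi(1), of "?r t"] hi(2) lo by auto
  qed
  define D where "D = {t..T} \<inter> ?r -` {w \<in> C. e \<le> f w}"
  have "closed (?r -` {w \<in> C. e \<le> f w})"
    by (rule closed_vimage[OF closed_superlevel[OF e] r])
  then have "compact D"
    unfolding D_def by (intro compact_Int_closed) auto
  moreover have "T \<in> D"
    using hi tT by (simp add: D_def)
  ultimately obtain s where s: "s \<in> D" "\<And>s'. s' \<in> D \<Longrightarrow> s \<le> s'"
    using compact_attains_inf[of D] by blast
  have "f (?r s) = e"
  proof (rule ccontr)
    assume "f (?r s) \<noteq> e"
    then have gt: "e < f (?r s)" "?r s \<in> C" using s(1) by (auto simp: D_def)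
    then have "t < s" using lo s(1) by (cases "s = t") (auto simp: D_def)
    have "open (?r -` (C \<inter> {w. e < f w}))"
      by (intro open_vimage[OF _ r] open_Int open_component open_Collect_less cont continuous_on_const)
    then obtain d where d: "0 < d" "\<And>s'. dist s' s < d \<Longrightarrow> ?r s' \<in> C \<and> e < f (?r s')"
      using gt unfolding open_dist by (auto simp: Ball_def)
    define s' where "s' = max t (s - d / 2)"
    have "s' < s" "t \<le> s'" "dist s' s < d"
      using d(1) \<open>t < s\<close> by (auto simp: s'_def dist_real_def)
    then have "s' \<in> D"
      using d(2)[of s'] s(1) by (auto simp: D_def)
    then show False using s(2)[of s'] \<open>s' < s\<close> by simp
  qed
  then show ?thesis
    using that[of s] s(1) by (auto simp: D_def)
qed

lemma compact_bounded_superlevel: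
  assumes "0 < e"
  shows "compact {x \<in> C. e \<le> f x \<and> (\<forall>k. k \<notin> A \<longrightarrow> x $ k = 0) \<and> (\<Sum>k\<in>A. x $ k) \<le> B}"
    (is "compact ?S")
proof -
  let ?l = "\<chi> k. - \<bar>L\<bar>" and ?h = "\<chi> k. \<bar>B\<bar> + (1 + real (card A)) * \<bar>L\<bar>"
  have "- \<bar>L\<bar> \<le> x $ k \<and> x $ k \<le> \<bar>B\<bar> + (1 + real (card A)) * \<bar>L\<bar>" if x: "x \<in> ?S" for x k
  proof (cases "k \<in> A")
    case True
    have "real (card (A - {k})) * - \<bar>L\<bar> \<le> (\<Sum>k\<in>A - {k}. x $ k)"
      using x lower by (intro sum_bounded_below) fastforce
    moreover have "(\<Sum>k\<in>A. x $ k) = x $ k + (\<Sum>k\<in>A - {k}. x $ k)"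
      by (rule sum.remove[OF _ True]) simp
    moreover have "real (card (A - {k})) * \<bar>L\<bar> \<le> real (card A) * \<bar>L\<bar>"
      by (intro mult_right_mono) (auto intro: card_mono)
    moreover have "(\<Sum>k\<in>A. x $ k) \<le> B" "L \<le> x $ k"
      using x lower[of x k] True by auto
    moreover have "0 \<le> real (card A) * \<bar>L\<bar>" by simp
    ultimately show ?thesis
      unfolding distrib_right by linarith
  next
    case False
    then show ?thesis using x by simp
  qed
  then have "?S \<subseteq> cbox ?l ?h"
    by (auto simp: mem_box_cart)
  moreover have "closed ?S"
  proof -
    have "?S = {x \<in> C. e \<le> f x} \<inter> (\<Inter>k\<in>- A. {x. x $ k = 0}) \<inter> {x. (\<Sum>k\<in>A. x $ k) \<le> B}"
      by auto
    also have "closed \<dots>"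
      by (intro closed_Int closed_INT closed_superlevel[OF assms] ballI
          closed_Collect_eq closed_Collect_le continuous_intros)
    finally show ?thesis .
  qed
  ultimately show ?thesis
    using compact_Int_closed[OF compact_cbox, of ?S ?l ?h] by (simp add: Int_absorb1)
qed

lemma sum_average:
  assumes "i \<in> A" "j \<in> A" "i \<noteq> j"
  shows "(\<Sum>k\<in>A. upd (upd x i m) j m $ k) = (\<Sum>k\<in>A. x $ k) - (x $ i + x $ j) + 2 * m"
proof -
  have 1: "(\<Sum>k\<in>A. upd x i m $ k) = (\<Sum>k\<in>A. x $ k) - x $ i + m" if "i \<in> A" for x i
    using that by (simp add: sum.remove[of A i] del: sum.If_cases)
  show ?thesis
    unfolding 1[OF assms(2)] 1[OF assms(1)] using assms(3) by simp
qed

text \<open>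
  Suppose that the segment from \<open>x0\<close> to \<open>y0\<close> leaves \<open>C\<close> at the weights \<open>u\<close>, \<open>v\<close>.  Consider all triples
  \<open>(x, y, t)\<close>, with \<open>x\<close>, \<open>y\<close> in \<open>{f \<ge> e}\<close> of bounded coordinate sum, such that the point
  \<open>u x + v y + t (1, ..., 1)\<close> lies on the level \<open>f = e\<close>; the number \<open>t\<close> measures how badly convexity
  fails for \<open>x\<close> and \<open>y\<close>.  Averaging two coordinates of \<open>x\<close> and of \<open>y\<close> does not decrease the attainable
  \<open>t\<close>, and it decreases the coordinate sums unless nothing changes.  Hence a triple that maximises \<open>t\<close>
  minus a small multiple of the sums has \<open>x\<close> and \<open>y\<close> on the diagonal and on the level \<open>e\<close>, which forces
  \<open>x = y\<close> and \<open>t = 0\<close>.  If the multiple is small enough, the initial pair beats this value.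

  Coordinates outside \<open>A\<close> are set to zero to make the set of triples compact.
\<close>

lemma convex_segment_on_slice:
  assumes cv: "\<And>i. i \<in> A \<Longrightarrow> convex (cyl i C)" and two: "i0 \<in> A" "j0 \<in> A" "i0 \<noteq> j0"
    and x0: "x0 \<in> C" "\<And>k. k \<notin> A \<Longrightarrow> x0 $ k = 0"
    and y0: "y0 \<in> C" "\<And>k. k \<notin> A \<Longrightarrow> y0 $ k = 0"
    and uv: "0 \<le> u" "0 \<le> v" "u + v = 1"
  shows "u *\<^sub>R x0 + v *\<^sub>R y0 \<in> C"
proof (rule ccontr)
  assume out: "u *\<^sub>R x0 + v *\<^sub>R y0 \<notin> C"
  define e where "e = min (f x0) (f y0)"
  have e: "0 < e" "e \<le> f x0" "e \<le> f y0"
    using pos x0 y0 by (auto simp: e_def)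
  define \<sigma> where "\<sigma> x = (\<Sum>k\<in>A. x $ k)" for x :: "real ^ 'n"
  define B where "B = max (\<sigma> x0) (\<sigma> y0)"
  define S where "S = {x \<in> C. e \<le> f x \<and> (\<forall>k. k \<notin> A \<longrightarrow> x $ k = 0) \<and> \<sigma> x \<le> B}"
  have S: "compact S"
    unfolding S_def \<sigma>_def by (rule compact_bounded_superlevel[OF e(1)])
  define F where "F = {w \<in> C. e \<le> f w} \<inter> {w. f w = e}"
  have F: "closed F" "\<And>w. w \<in> F \<longleftrightarrow> w \<in> C \<and> f w = e"
    unfolding F_def using cont
    by (auto intro!: closed_Int closed_superlevel[OF e(1)] closed_Collect_eq)
  let ?g = "\<lambda>(x, y, t). u *\<^sub>R x + v *\<^sub>R y + t *\<^sub>R (1 :: real ^ 'n)"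
  (* Points this far up the diagonal dominate x0 strictly in every coordinate of A. *)
  define T where "T = norm x0 + 1 - L"
  have far: "u *\<^sub>R x + v *\<^sub>R y + t *\<^sub>R 1 \<in> C \<and> e < f (u *\<^sub>R x + v *\<^sub>R y + t *\<^sub>R 1)"
    if "x \<in> S" "y \<in> S" "T \<le> t" for x y t
  proof -
    have above: "x0 $ k + 1 \<le> (u *\<^sub>R x + v *\<^sub>R y + t *\<^sub>R 1) $ k" if "k \<in> A" for k
    proof -
      have "u * L + v * L \<le> u * x $ k + v * y $ k"
        using \<open>x \<in> S\<close> \<open>y \<in> S\<close> lower that uv by (intro add_mono mult_left_mono) (auto simp: S_def)
      then have "L \<le> u * x $ k + v * y $ k"
        using uv(3) by (simp flip: distrib_right)
      moreover have "x0 $ k \<le> norm x0"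
        using component_le_norm_cart[of x0 k] by simp
      ultimately show ?thesis
        using \<open>T \<le> t\<close> by (simp add: T_def)
    qed
    have "x0 $ k \<le> (u *\<^sub>R x + v *\<^sub>R y + t *\<^sub>R 1) $ k" if "k \<in> A" for k
      using above[OF that] by linarith
    moreover have "x0 $ i0 < (u *\<^sub>R x + v *\<^sub>R y + t *\<^sub>R 1) $ i0"
      using above[OF two(1)] by linarith
    ultimately show ?thesis
      using monotone_on_component(1)[OF x0(1), of "u *\<^sub>R x + v *\<^sub>R y + t *\<^sub>R 1"] e(2)
        strict_monotone_on_component[OF x0(1) _ two(1), of "u *\<^sub>R x + v *\<^sub>R y + t *\<^sub>R 1"]
      by fastforce
  qed
  define K where "K = (S \<times> S \<times> {0..T}) \<inter> ?g -` F"
  have "compact K"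
    unfolding K_def
    by (intro compact_Int_closed compact_Times S compact_Icc closed_vimage[OF F(1)])
      (auto simp: case_prod_unfold intro!: continuous_intros)
  have exit: "\<exists>s\<ge>t. (x, y, s) \<in> K"
    if xy: "x \<in> S" "y \<in> S" and t: "0 \<le> t"
      and lo: "\<not> (u *\<^sub>R x + v *\<^sub>R y + t *\<^sub>R 1 \<in> C \<and> e < f (u *\<^sub>R x + v *\<^sub>R y + t *\<^sub>R 1))" for x y t
  proof -
    obtain s where s: "t \<le> s" "u *\<^sub>R x + v *\<^sub>R y + s *\<^sub>R 1 \<in> C" "f (u *\<^sub>R x + v *\<^sub>R y + s *\<^sub>R 1) = e"
      using boundary_above[OF e(1) _ _ lo, of T] far[OF xy] by blast
    have "s \<le> T"
      using far[OF xy, of s] s(3) by fastforce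
    with s t xy F(2) show ?thesis
      by (auto simp: K_def)
  qed
  have S0: "x0 \<in> S" "y0 \<in> S"
    using x0 y0 e by (auto simp: S_def B_def)
  obtain t0 where t0: "0 \<le> t0" "(x0, y0, t0) \<in> K"
    using exit[OF S0, of 0] out by auto
  have "t0 \<noteq> 0"
  proof
    assume "t0 = 0"
    then have "u *\<^sub>R x0 + v *\<^sub>R y0 \<in> F"
      using t0(2) by (simp add: K_def)
    then show False using F(2) out by simp
  qed
  with t0(1) have t0_pos: "0 < t0" by simp
  have \<sigma>_lower: "card A * L \<le> \<sigma> x" if "x \<in> S" for x
    unfolding \<sigma>_def using that lower by (intro sum_bounded_below) (auto simp: S_def)
  (* The sums of a pair in S vary by at most N - 1, so the weight d = t0 / N below makes their
     total influence on the objective smaller than t0. *)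
  define N where "N = 1 + 2 * (B - card A * L)"
  have N: "0 < N"
    using \<sigma>_lower[OF S0(1)] by (simp add: N_def B_def)
  define d where "d = t0 / N"
  have d: "0 < d" "d * N = t0"
    using N t0_pos by (simp_all add: d_def)
  let ?\<Phi> = "\<lambda>(x, y, t). t - d * (\<sigma> x + \<sigma> y)"
  have "continuous_on K ?\<Phi>"
    unfolding \<sigma>_def case_prod_unfold by (intro continuous_intros)
  then obtain q where q: "q \<in> K" "\<forall>r\<in>K. ?\<Phi> r \<le> ?\<Phi> q"
    using continuous_attains_sup[OF \<open>compact K\<close>] t0(2) by blast
  obtain x y t where qe: "q = (x, y, t)" by (cases q)
  have xyt: "x \<in> S" "y \<in> S" "0 \<le> t" "u *\<^sub>R x + v *\<^sub>R y + t *\<^sub>R 1 \<in> C"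
      "f (u *\<^sub>R x + v *\<^sub>R y + t *\<^sub>R 1) = e"
    using q(1) F(2) by (auto simp: K_def qe)
  have max: "t' - d * (\<sigma> x' + \<sigma> y') \<le> t - d * (\<sigma> x + \<sigma> y)" if "(x', y', t') \<in> K" for x' y' t'
    using q(2) that by (auto simp: qe)
  have diag: "x $ i = x $ j \<and> y $ i = y $ j \<and> f x = e \<and> f y = e"
    if ij: "i \<in> A" "j \<in> A" "i \<noteq> j" for i j
  proof -
    have xC: "x \<in> C" "e \<le> f x" "y \<in> C" "e \<le> f y"
      using xyt by (auto simp: S_def)
    obtain m where m: "upd (upd x i m) j m \<in> C" "f (upd (upd x i m) j m) = e"
      "2 * m \<le> x $ i + x $ j" "2 * m = x $ i + x $ j \<Longrightarrow> x $ i = m \<and> x $ j = m"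
      using average_coordinates[OF ij xC(1) e(1) xC(2)] by blast
    obtain n where n: "upd (upd y i n) j n \<in> C" "f (upd (upd y i n) j n) = e"
      "2 * n \<le> y $ i + y $ j" "2 * n = y $ i + y $ j \<Longrightarrow> y $ i = n \<and> y $ j = n"
      using average_coordinates[OF ij xC(3) e(1) xC(4)] by blast
    define x' y' where "x' = upd (upd x i m) j m" and "y' = upd (upd y i n) j n"
    have \<sigma>': "\<sigma> x' = \<sigma> x - (x $ i + x $ j) + 2 * m" "\<sigma> y' = \<sigma> y - (y $ i + y $ j) + 2 * n"
      unfolding \<sigma>_def x'_def y'_def by (rule sum_average[OF ij])+
    have S': "x' \<in> S" "y' \<in> S"
      using xyt(1,2) m n \<sigma>' ij by (auto simp: S_def x'_def y'_def)
    have "\<not> (u *\<^sub>R x' + v *\<^sub>R y' + t *\<^sub>R 1 \<in> C \<and> e < f (u *\<^sub>R x' + v *\<^sub>R y' + t *\<^sub>R 1))"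
      using averaging_reflects_interior(2)[OF ij cv[OF ij(1)] xC e(1) x'_def _ _ y'_def _ _ uv xyt(3)]
        m(1,2) n(1,2) xyt(5) by (auto simp: x'_def y'_def)
    then obtain s where s: "t \<le> s" "(x', y', s) \<in> K"
      using exit[OF S' xyt(3)] by blast
    have "d * (\<sigma> x + \<sigma> y) \<le> d * (\<sigma> x' + \<sigma> y')"
      using max[OF s(2)] s(1) by linarith
    then have "\<sigma> x + \<sigma> y \<le> \<sigma> x' + \<sigma> y'"
      using d(1) by simp
    then have "2 * m = x $ i + x $ j" "2 * n = y $ i + y $ j"
      using m(3) n(3) \<sigma>' by linarith+
    with m(4) n(4) have mn: "x $ i = m" "x $ j = m" "y $ i = n" "y $ j = n" by auto
    then have "upd (upd x i m) j m = x" "upd (upd y i n) j n = y"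
      by (auto simp: vec_eq_iff)
    with m(2) n(2) mn show ?thesis by simp
  qed
  have const: "x $ k = x $ i0" "y $ k = y $ i0" if "k \<in> A" for k
    using diag[OF that two(1)] by (cases "k = i0"; simp)+
  have lev: "f x = e" "f y = e" "x \<in> C" "y \<in> C"
    using diag[OF two] xyt by (auto simp: S_def)
  have not_less: "\<not> a $ i0 < b $ i0"
    if "a \<in> C" "f a = e" "f b = e" "\<And>k. k \<in> A \<Longrightarrow> a $ k = a $ i0 \<and> b $ k = b $ i0" for a b
    using strict_monotone_on_component[OF that(1) _ two(1), of b] that(2-4) by fastforce
  have "x $ i0 = y $ i0"
    using not_less[of x y] not_less[of y x] lev const by (metis linorder_less_linear)
  then have "x $ k = y $ k" for k
    using const[of k] xyt(1,2) by (cases "k \<in> A") (auto simp: S_def)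
  then have xy: "x = y" by (simp add: vec_eq_iff)
  have w: "u *\<^sub>R x + v *\<^sub>R y + t *\<^sub>R 1 = x + t *\<^sub>R 1"
    using uv(3) by (simp add: xy flip: scaleR_add_left)
  have "t = 0"
    using not_less[of x "x + t *\<^sub>R 1"] lev xyt(3,5) const unfolding w by fastforce
  then have "t0 \<le> d * (\<sigma> x0 + \<sigma> y0 - 2 * \<sigma> x)"
    using max[OF t0(2)] by (simp add: xy algebra_simps)
  also have "\<dots> \<le> d * (2 * (B - card A * L))"
    using \<sigma>_lower[OF xyt(1)] d(1) by (intro mult_left_mono) (auto simp: B_def)
  also have "\<dots> < d * N"
    using d(1) by (simp add: N_def)
  finally show False unfolding d(2) by simp
qed

text \<open>
  With at least two variables the averaging argument applies.  With at most one, a convex combination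
  of \<open>x\<close> and \<open>y\<close> dominates one of them, and \<open>C\<close> is an upper set.
\<close>

lemma convex_induction_step:
  assumes cv: "\<And>i. i \<in> A \<Longrightarrow> convex (cyl i C)"
  shows "convex C"
proof (rule convexI)
  fix x y u v
  assume xy: "x \<in> C" "y \<in> C" and uv: "0 \<le> u" "0 \<le> v" "u + v = (1 :: real)"
  show "u *\<^sub>R x + v *\<^sub>R y \<in> C"
  proof (cases "\<exists>i j. i \<in> A \<and> j \<in> A \<and> i \<noteq> j")
    case True
    then obtain i j where two: "i \<in> A" "j \<in> A" "i \<noteq> j" by blast
    define r where "r x = (\<chi> k. if k \<in> A then x $ k else 0)" for x :: "real ^ 'n"
    have r: "r x \<in> C" if "x \<in> C" for x
      by (rule monotone_on_component(1)[OF that]) (simp add: r_def)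
    have "u *\<^sub>R r x + v *\<^sub>R r y \<in> C"
      by (rule convex_segment_on_slice[OF cv two r[OF xy(1)] _ r[OF xy(2)] _ uv]) (auto simp: r_def)
    then show ?thesis
      by (rule monotone_on_component(1)) (simp add: r_def)
  next
    case False
    then obtain i where i: "A \<subseteq> {i}" by blast
    have between: "min (x $ i) (y $ i) \<le> (u *\<^sub>R x + v *\<^sub>R y) $ i"
    proof -
      have "u * min (x $ i) (y $ i) + v * min (x $ i) (y $ i) \<le> u * x $ i + v * y $ i"
        using uv by (intro add_mono mult_left_mono) auto
      then show ?thesis using uv(3) by (simp flip: distrib_right)
    qed
    show ?thesis
    proof (cases "x $ i \<le> y $ i")
      case True
      then show ?thesis
        by (intro monotone_on_component(1)[OF xy(1)]) (use between i in auto)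
    next
      case False
      then show ?thesis
        by (intro monotone_on_component(1)[OF xy(2)]) (use between i in auto)
    qed
  qed
qed

end

lemma stable_component_convex:
  assumes "stable_component A f C L"
  shows "convex C"
  using assms
proof (induction "card A" arbitrary: A f C)
  case 0
  interpret stable_component A f C L by fact
  show ?case
    by (rule convex_induction_step) (use 0 in simp)
next
  case (Suc n)
  interpret stable_component A f C L by fact
  show ?case
  proof (rule convex_induction_step)
    fix i assume i: "i \<in> A"
    show "convex (cyl i C)"
      using Suc.hyps stable_component_slope[OF i] i by (intro Suc.hyps(1)) auto
  qed
qed

section \<open>Elementary symmetric polynomials\<close>

lemma elem_sym_affine:
  "elem_sym k (upd x i t) = elem_sym k (upd x i 0) + t * slope (elem_sym k) i x"
proof -
  have "(\<Prod>l\<in>S. upd x i t $ l) =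
      (\<Prod>l\<in>S. upd x i 0 $ l) + t * ((\<Prod>l\<in>S. upd x i 1 $ l) - (\<Prod>l\<in>S. upd x i 0 $ l))"
    for S :: "'a set"
  proof (cases "i \<in> S")
    case True
    have "(\<Prod>l\<in>S. upd x i r $ l) = r * (\<Prod>l\<in>S - {i}. x $ l)" for r
      using True by (simp add: prod.remove[of S i])
    then show ?thesis by simp
  next
    case False
    then have "(\<Prod>l\<in>S. upd x i r $ l) = (\<Prod>l\<in>S. x $ l)" for r
      by (intro prod.cong) auto
    then show ?thesis by simp
  qed
  then have "elem_sym k (upd x i t) = (\<Sum>S | S \<subseteq> UNIV \<and> card S = k.
      (\<Prod>l\<in>S. upd x i 0 $ l) + t * ((\<Prod>l\<in>S. upd x i 1 $ l) - (\<Prod>l\<in>S. upd x i 0 $ l)))"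
    unfolding elem_sym_def by (rule sum.cong[OF refl])
  then show ?thesis
    by (simp add: slope_def elem_sym_def sum.distrib sum_distrib_left
        sum_subtractf right_diff_distrib del: upd_nth)
qed

lemma elem_sym_permute:
  assumes "bij p"
  shows "elem_sym k (\<chi> l. x $ p l) = elem_sym k x"
proof -
  have inj: "inj_on p S" for S
    using bij_is_inj[OF assms] by (rule inj_on_subset) simp
  have "bij_betw (image p) {S. card S = k} {S. card S = k}"
  proof (rule bij_betw_byWitness[where f' = "image (inv p)"])
    have "inj_on (inv p) S" for S
      using bij_is_inj[OF bij_imp_bij_inv[OF assms]] by (rule inj_on_subset) simp
    then show "(`) (inv p) ` {S. card S = k} \<subseteq> {S. card S = k}"
      by (auto simp: card_image)
    show "(`) p ` {S. card S = k} \<subseteq> {S. card S = k}"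
      by (auto simp: card_image[OF inj])
  qed (use assms in \<open>auto simp: image_comp bij_def surj_iff\<close>)
  then have "elem_sym k x = (\<Sum>S | card S = k. \<Prod>l\<in>p ` S. x $ l)"
    by (simp add: elem_sym_def sum.reindex_bij_betw[of "image p", symmetric])
  then show ?thesis
    by (simp add: elem_sym_def prod.reindex[OF inj])
qed

lemma elem_sym_upd_swap:
  assumes "i \<noteq> j"
  shows "elem_sym k (upd (upd x i s) j t) = elem_sym k (upd (upd x i t) j s)"
proof -
  have "upd (upd x i s) j t = (\<chi> l. upd (upd x i t) j s $ Transposition.transpose i j l)"
    using assms by (auto simp: vec_eq_iff Transposition.transpose_def)
  then show ?thesis
    by (simp only: elem_sym_permute bij_swap_iff bij_id bij_transpose)
qed

lemma continuous_elem_sym: "continuous_on S (elem_sym k)"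
  unfolding elem_sym_def by (intro continuous_intros)

section \<open>Convexity of the boundary\<close>

theorem theorem1p1:
  fixes n :: nat and c :: "nat \<Rightarrow> real"
    and f :: "real ^ 'm::finite option \<Rightarrow> real"
    and G :: "(real ^ 'm option) set"
  assumes "n = CARD('m option)"
    and "\<And>x. f x = elem_sym n x - (\<Sum>k = 0..n - 1. c k * elem_sym k x)"
    and "G \<in> components {x. f x > 0}"
    and "strictly_Upsilon_stable G"
  shows "convex_boundary G"
proof -
  obtain q where q: "G \<subseteq> (+) q ` pos_orthant"
    using assms(4) by (auto simp: strictly_Upsilon_stable_def Upsilon_stable_def)
  have affine: "f (upd x i t) = f (upd x i 0) + t * slope f i x" for x i t
    unfolding slope_def assms(2)
    by (subst (1 2) elem_sym_affine) (simp add: slope_def algebra_simps sum.distrib sum_distrib_left sum_subtractf)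
  have "stable_component UNIV f G (Min (range (($) q)))"
  proof
    show "f (upd x i t) = f (upd x i 0) + t * slope f i x" for x i t
      by (rule affine)
    show "f (upd (upd x i s) j t) = f (upd (upd x i t) j s)" if "i \<noteq> j" for x i j s t
      unfolding assms(2) by (simp only: elem_sym_upd_swap[OF that])
    show "0 < f x" if "x \<in> G" for x
      using that in_components_subset[OF assms(3)] by auto
  next
    fix x i t assume x: "x \<in> G" and p: "0 < f (upd x i t)"
    have fx: "0 < f x" using x in_components_subset[OF assms(3)] by auto
    (* f is affine on the axis-parallel segment, so the segment lies in {f > 0}. *)
    have "closed_segment x (upd x i t) \<subseteq> {x. f x > 0}"
    proof
      fix w assume "w \<in> closed_segment x (upd x i t)"
      then obtain r where r: "0 \<le> r" "r \<le> 1" "w = (1 - r) *\<^sub>R x + r *\<^sub>R upd x i t"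
        by (auto simp: closed_segment_def)
      have "w = upd x i ((1 - r) * x $ i + r * t)"
        unfolding r(3) by (simp add: vec_eq_iff algebra_simps)
      then have "f w = (1 - r) * f x + r * f (upd x i t)"
        using affine[of x i "x $ i"] affine[of x i t] affine[of x i "(1 - r) * x $ i + r * t"]
        by (simp add: algebra_simps)
      also have "0 < \<dots>"
        using r(1,2) fx p by (cases "r = 0") (auto intro!: add_nonneg_pos)
      finally show "w \<in> {x. f x > 0}" by simp
    qed
    then have "closed_segment x (upd x i t) \<subseteq> G"
      using x by (intro components_maximal[OF assms(3)]) auto
    then show "upd x i t \<in> G" by auto
  next
    fix x i assume "x \<in> G"
    then have "q $ i < x $ i"
      using q by (auto simp: pos_orthant_def)
    then show "Min (range (($) q)) \<le> x $ i"
      by (meson Min_le finite_code finite_imageI less_imp_le order_trans rangeI)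
  next
    show "continuous_on UNIV f"
      unfolding assms(2) by (intro continuous_intros continuous_elem_sym)
  qed simp
  then have "convex G"
    by (rule stable_component_convex)
  then show ?thesis
    unfolding convex_boundary_def by (rule convex_closure)
qed

end
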